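(* For any pair of graded posets $P$ and $Q$, $$I_2(P\times Q)=I_2(P)\,(\times)\,I_2(Q)$$ holds as multisets of posets (up to isomorphism), where $I_2(P)\,(\times)\,I_2(Q)$ denotes the multiset of posets $\{P_1\times Q_1:\ P_1\in I_2(P),\ Q_1\in I_2(Q)\}$.
   Context: All posets are finite. A poset is graded if it has a unique minimum $\widehat{0}$, a unique maximum $\widehat{1}$ and a rank function $\rho$ with $\rho(\widehat 0)=0$ and $\rho(y)=\rho(x)+1$ whenever $y$ covers $x$. The direct product $P\times Q$ is the set of ordered pairs $(u,v)$, $u\in P$, $v\in Q$, with $(u_1,v_1)\le(u_2,v_2)$ iff $u_1\le u_2$ and $v_1\le v_2$. $I(P)$ is the set of all (nonempty) intervals $[y,z]=\{w\in P:y\le w\le z\}$ of $P$, ordered by inclusion. The interval transform of the second kind $I_2(P)$ is the multiset of subposets of $I(P)$ containing, for each $x\in P$, the subposet of all $[y,z]\in I(P)$ containing $[x,x]$ (including $[x,x]$ itself); for graded $P$ this is the interval $[[x,x],[\widehat 0,\widehat 1]]$ of $I(P)$. *)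

theory Defs
  imports "HOL-Library.Multiset"
begin

text \<open>A poset is given by its (reflexive) order relation \<open>P\<close>: the underlying set is
  \<open>Field P\<close>, and \<open>(x, y) \<in> P\<close> means \<open>x \<le> y\<close>.\<close>

definition finite_poset :: "'a rel \<Rightarrow> bool" where
  "finite_poset P \<longleftrightarrow> Partial_order P \<and> finite (Field P)"

definition is_minimum :: "'a rel \<Rightarrow> 'a \<Rightarrow> bool" where
  "is_minimum P b \<longleftrightarrow> b \<in> Field P \<and> (\<forall>x\<in>Field P. (b, x) \<in> P)"

definition is_maximum :: "'a rel \<Rightarrow> 'a \<Rightarrow> bool" where
  "is_maximum P t \<longleftrightarrow> t \<in> Field P \<and> (\<forall>x\<in>Field P. (x, t) \<in> P)"

definition covers :: "'a rel \<Rightarrow> 'a \<Rightarrow> 'a \<Rightarrow> bool" where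
  "covers P y x \<longleftrightarrow> (x, y) \<in> P \<and> x \<noteq> y \<and>
     \<not> (\<exists>w. (x, w) \<in> P \<and> (w, y) \<in> P \<and> w \<noteq> x \<and> w \<noteq> y)"

definition graded_poset :: "'a rel \<Rightarrow> bool" where
  "graded_poset P \<longleftrightarrow> finite_poset P \<and>
     (\<exists>!b. is_minimum P b) \<and> (\<exists>!t. is_maximum P t) \<and>
     (\<exists>\<rho> :: 'a \<Rightarrow> nat. (\<forall>b. is_minimum P b \<longrightarrow> \<rho> b = 0) \<and>
        (\<forall>x y. covers P y x \<longrightarrow> \<rho> y = \<rho> x + 1))"

definition poset_iso :: "'a rel \<Rightarrow> 'b rel \<Rightarrow> bool" where
  "poset_iso P Q \<longleftrightarrow> (\<exists>f. bij_betw f (Field P) (Field Q) \<and>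
     (\<forall>x\<in>Field P. \<forall>y\<in>Field P. (x, y) \<in> P \<longleftrightarrow> (f x, f y) \<in> Q))"

definition poset_prod :: "'a rel \<Rightarrow> 'b rel \<Rightarrow> ('a \<times> 'b) rel" where
  "poset_prod P Q = {((u1, v1), (u2, v2)) | u1 v1 u2 v2. (u1, u2) \<in> P \<and> (v1, v2) \<in> Q}"

definition interval :: "'a rel \<Rightarrow> 'a \<Rightarrow> 'a \<Rightarrow> 'a set" where
  "interval P y z = {w \<in> Field P. (y, w) \<in> P \<and> (w, z) \<in> P}"

definition interval_poset :: "'a rel \<Rightarrow> 'a set rel" where
  "interval_poset P = relation_of (\<subseteq>) {interval P y z | y z. (y, z) \<in> P}"

definition intervals_containing :: "'a rel \<Rightarrow> 'a \<Rightarrow> 'a set rel" where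
  "intervals_containing P x =
     Restr (interval_poset P) {J \<in> Field (interval_poset P). interval P x x \<subseteq> J}"

definition I2 :: "'a rel \<Rightarrow> 'a set rel multiset" where
  "I2 P = image_mset (intervals_containing P) (mset_set (Field P))"

definition mset_poset_prod :: "'a rel multiset \<Rightarrow> 'b rel multiset \<Rightarrow> ('a \<times> 'b) rel multiset" where
  "mset_poset_prod M N = (\<Sum>P1\<in>#M. image_mset (\<lambda>Q1. poset_prod P1 Q1) N)"

text \<open>Equality of multisets up to isomorphism of their elements: some pairing of the two
  multisets, respecting multiplicities, matches isomorphic posets.\<close>

definition mset_poset_eq :: "'a rel multiset \<Rightarrow> 'b rel multiset \<Rightarrow> bool" where
  "mset_poset_eq M N \<longleftrightarrow> rel_mset poset_iso M N"

lemma Field_interval_poset: "Field (interval_poset P) = {interval P y z | y z. (y, z) \<in> P}"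
  unfolding interval_poset_def by (rule Field_relation_of) (auto simp: refl_on_def relation_of_def)

lemma Field_intervals_containing:
  "Field (intervals_containing P x) = {J \<in> Field (interval_poset P). interval P x x \<subseteq> J}"
  unfolding intervals_containing_def interval_poset_def
  by (auto simp: Field_def relation_of_def)

lemma Field_poset_prod:
  assumes "Refl P" and "Refl Q"
  shows "Field (poset_prod P Q) = Field P \<times> Field Q"
  using assms unfolding poset_prod_def refl_on_def Field_def by fastforce

text \<open>For a graded poset, \<open>intervals_containing P x\<close> is the interval
  \<open>[[x, x], [0, 1]]\<close> of \<open>interval_poset P\<close>.\<close>

lemma Field_intervals_containing_graded:
  assumes "graded_poset P" and "is_minimum P b" and "is_maximum P t" and "x \<in> Field P"
  shows "Field (intervals_containing P x) =
    interval (interval_poset P) (interval P x x) (interval P b t)"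
proof -
  have refl: "(x, x) \<in> P"
    using assms(1,4) by (auto simp: graded_poset_def finite_poset_def dest!: partial_order_onD(1) simp: refl_on_def)
  have bt: "(b, t) \<in> P" using assms(2,3) by (auto simp: is_minimum_def is_maximum_def)
  have sub: "interval P y z \<subseteq> interval P b t" for y z
    using assms(2,3) by (auto simp: interval_def is_minimum_def is_maximum_def)
  show ?thesis
    unfolding Field_intervals_containing interval_def[of "interval_poset P"] Field_interval_poset
    unfolding interval_poset_def relation_of_def using refl bt sub by blast
qed

end

theory Submission
  imports Defs
begin

text \<open>The intervals of \<open>P \<times> Q\<close> are exactly the products \<open>J \<times> K\<close> of intervals of \<open>P\<close> and \<open>Q\<close>; all
  factors are nonempty, so inclusion of such products is componentwise inclusion. Hence
  \<open>J \<times> K \<mapsto> (J, K)\<close> is an isomorphism from the member of \<open>I\<^sub>2(P \<times> Q)\<close> at \<open>(x, u)\<close> to the product of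
  the members at \<open>x\<close> and \<open>u\<close>.\<close>

lemma poset_prod_iff [simp]:
  "((a, b), (c, d)) \<in> poset_prod P Q \<longleftrightarrow> (a, c) \<in> P \<and> (b, d) \<in> Q"
  by (simp add: poset_prod_def)

lemma interval_poset_prod:
  assumes "Refl P" and "Refl Q"
  shows "interval (poset_prod P Q) (y, v) (z, w) = interval P y z \<times> interval Q v w"
  by (auto simp: interval_def Field_poset_prod assms)

lemma interval_nonempty: "Refl P \<Longrightarrow> (y, z) \<in> P \<Longrightarrow> interval P y z \<noteq> {}"
  by (auto simp: interval_def refl_on_def Field_def)

text \<open>Both \<open>interval_poset\<close> and its restriction carry plain inclusion, so every
  later comparison reduces to membership in the field and \<open>J \<subseteq> K\<close>.\<close>

lemma intervals_containing_iff:
  "(J, K) \<in> intervals_containing P x \<longleftrightarrow>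
     J \<in> Field (intervals_containing P x) \<and> K \<in> Field (intervals_containing P x) \<and> J \<subseteq> K"
proof -
  have "(J, K) \<in> interval_poset P \<longleftrightarrow>
      J \<in> Field (interval_poset P) \<and> K \<in> Field (interval_poset P) \<and> J \<subseteq> K"
    by (auto simp: Field_interval_poset) (auto simp: interval_poset_def relation_of_def)
  then show ?thesis
    by (auto simp: Field_intervals_containing) (auto simp: intervals_containing_def)
qed

lemma Refl_intervals_containing: "Refl (intervals_containing P x)"
  by (simp add: refl_on_def intervals_containing_iff)

lemma intervals_containing_nonempty:
  "Refl P \<Longrightarrow> J \<in> Field (intervals_containing P x) \<Longrightarrow> J \<noteq> {}"
  by (auto simp: Field_intervals_containing Field_interval_poset interval_nonempty)

text \<open>The least element at \<open>(x, u)\<close> is the product of those at \<open>x\<close>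
  and \<open>u\<close>. As these are nonempty, a product \<open>J \<times> K\<close> contains it iff
  each factor contains its own.\<close>

lemma Field_intervals_containing_prod:
  assumes "Refl P" and "Refl Q" and "x \<in> Field P" and "u \<in> Field Q"
  shows "Field (intervals_containing (poset_prod P Q) (x, u)) =
    (\<lambda>(J, K). J \<times> K) ` (Field (intervals_containing P x) \<times> Field (intervals_containing Q u))"
proof -
  have "interval P x x \<noteq> {}" "interval Q u u \<noteq> {}"
    using assms by (simp_all add: interval_nonempty refl_on_def)
  then show ?thesis
    by (fastforce simp: Field_intervals_containing Field_interval_poset
        interval_poset_prod assms(1,2) times_subset_iff image_iff)
qed

lemma intervals_containing_prod_iso:
  assumes "Refl P" and "Refl Q" and "x \<in> Field P" and "u \<in> Field Q"
  shows "poset_iso (intervals_containing (poset_prod P Q) (x, u))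
    (poset_prod (intervals_containing P x) (intervals_containing Q u))"
proof -
  let ?A = "Field (intervals_containing P x)" and ?B = "Field (intervals_containing Q u)"
  \<comment> \<open>The two projections recover \<open>J\<close> and \<open>K\<close> from
    \<open>J \<times> K\<close> because neither factor is empty.\<close>
  let ?f = "\<lambda>S. (fst ` S, snd ` S)"
  have ne: "J \<noteq> {}" "K \<noteq> {}" if "J \<in> ?A" "K \<in> ?B" for J K
    using that assms(1,2) by (auto dest: intervals_containing_nonempty)
  have f: "?f (J \<times> K) = (J, K)" if "J \<in> ?A" "K \<in> ?B" for J K
    using ne[OF that] by simp
  note Fprod = Field_intervals_containing_prod[OF assms]
  have "bij_betw ?f ((\<lambda>(J, K). J \<times> K) ` (?A \<times> ?B)) (?A \<times> ?B)"
    by (rule bij_betw_byWitness[where f' = "\<lambda>(J, K). J \<times> K"]) (auto simp: ne)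
  then show ?thesis
    unfolding poset_iso_def
      Field_poset_prod[OF Refl_intervals_containing Refl_intervals_containing]
    by (intro exI[of _ ?f])
      (auto simp: Fprod f ne times_subset_iff intervals_containing_iff[of _ _ "poset_prod P Q"]
        intervals_containing_iff[of _ _ P] intervals_containing_iff[of _ _ Q])
qed

text \<open>Rewrites the product multiset as one family indexed by \<open>A \<times> B\<close>, the
  shape \<open>I2\<close> has for a product poset.\<close>

lemma mset_poset_prod_image_mset_set:
  assumes "finite A" and "finite B"
  shows "mset_poset_prod (image_mset f (mset_set A)) (image_mset g (mset_set B)) =
    image_mset (\<lambda>(x, u). poset_prod (f x) (g u)) (mset_set (A \<times> B))"
  using assms(1)
proof (induction A rule: finite_induct)
  case empty
  then show ?case by (simp add: mset_poset_prod_def)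
next
  case (insert a A)
  \<comment> \<open>The row over \<open>a\<close> is disjoint from the rest since \<open>a\<close>
    is not in \<open>A\<close>.\<close>
  have "mset_set (insert a A \<times> B) = mset_set (Pair a ` B) + mset_set (A \<times> B)"
    using insert.hyps assms(2)
    by (subst mset_set_Union[symmetric]) (auto intro!: arg_cong[where f = mset_set])
  moreover have "mset_set (Pair a ` B) = image_mset (Pair a) (mset_set B)"
    by (simp add: image_mset_mset_set inj_on_def)
  ultimately show ?case
    using insert by (simp add: mset_poset_prod_def multiset.map_comp comp_def)
qed

theorem proposition5p12:
  fixes P :: "'a rel" and Q :: "'b rel"
  assumes "graded_poset P" and "graded_poset Q"
  shows "mset_poset_eq (I2 (poset_prod P Q)) (mset_poset_prod (I2 P) (I2 Q))"
proof -
  have refl: "Refl P" "Refl Q" and fin: "finite (Field P)" "finite (Field Q)"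
    using assms by (auto simp: graded_poset_def finite_poset_def dest: partial_order_onD(1))
  show ?thesis
    unfolding mset_poset_eq_def I2_def Field_poset_prod[OF refl]
      mset_poset_prod_image_mset_set[OF fin] multiset.rel_map
    \<comment> \<open>Both sides are now indexed by the same multiset of pairs, so each index is
      matched with itself.\<close>
    by (rule multiset.rel_refl_strong) (auto simp: fin intro!: intervals_containing_prod_iso refl)
qed

end
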